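(* Let $K_{a,b}$ be the complete bipartite graph with parts of sizes $a$ and $b$, where $2\le a\le b\le 2a$. Then $$b_t^2(K_{a,b})=b.$$
   Context: $\gamma_t(K_{a,b})=2$ for $2\le a\le b$. A total dominating set of a graph without isolated vertices is a vertex set $S$ such that every vertex is adjacent to some vertex of $S$; $\gamma_t(G)$ is the minimum size of such a set. The $k$-total bondage number $b_t^k(G)$ is the minimum number of edges that must be deleted from $G$ so that the resulting graph (required to have no isolated vertices) has total domination number at least $\gamma_t(G)+k$. *)

theory Defs
  imports "Graph_Theory.Kuratowski" "HOL-Library.Extended_Nat"
begin

text \<open>
  Finite simple graphs are rendered by the locale \<open>graph\<close>: finite symmetric digraphs without
  loops and without parallel arcs. An undirected edge is thus a pair of opposite arcs, represented
  below by the set of its two end points, so that it is counted only once.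
\<close>

definition undirected_edges :: "('a, 'b) pre_digraph \<Rightarrow> 'a set set" where
  "undirected_edges G = {{u, v} | u v. u \<rightarrow>\<^bsub>G\<^esub> v}"

definition delete_edges :: "('a, 'b) pre_digraph \<Rightarrow> 'a set set \<Rightarrow> ('a, 'b) pre_digraph" where
  "delete_edges G F = G\<lparr>arcs := {e \<in> arcs G. {tail G e, head G e} \<notin> F}\<rparr>"

definition no_isolated_vertices :: "('a, 'b) pre_digraph \<Rightarrow> bool" where
  "no_isolated_vertices G \<longleftrightarrow> (\<forall>v \<in> verts G. \<exists>u \<in> verts G. v \<rightarrow>\<^bsub>G\<^esub> u)"

definition total_dominating_set :: "('a, 'b) pre_digraph \<Rightarrow> 'a set \<Rightarrow> bool" where
  "total_dominating_set G S \<longleftrightarrow> S \<subseteq> verts G \<and> (\<forall>v \<in> verts G. \<exists>u \<in> S. v \<rightarrow>\<^bsub>G\<^esub> u)"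

text \<open>
  Both minima below are infima in \<^typ>\<open>enat\<close>: an infimum over a nonempty set is attained, and an
  infimum over the empty set is \<open>\<infinity>\<close>. Hence an equation with a finite value also asserts that a
  minimising set exists. The first definition is meant for graphs without isolated vertices.
\<close>

definition total_domination_number :: "('a, 'b) pre_digraph \<Rightarrow> enat" where
  "total_domination_number G = (INF S \<in> {S. total_dominating_set G S}. enat (card S))"

definition total_bondage_number :: "nat \<Rightarrow> ('a, 'b) pre_digraph \<Rightarrow> enat" where
  "total_bondage_number k G =
     (INF F \<in> {F. F \<subseteq> undirected_edges G
               \<and> no_isolated_vertices (delete_edges G F)
               \<and> total_domination_number (delete_edges G F)
                   \<ge> total_domination_number G + enat k}. enat (card F))"

end

theory Submission
  imports Defs
begin

text \<open>
  Let \<open>U\<close> and \<open>V\<close> be the parts, of sizes \<open>a\<close> and \<open>b\<close>. Deleting the edges between \<open>v\<close> and \<open>f v\<close>,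
  for a surjection \<open>f\<close> from \<open>V\<close> onto \<open>U\<close>, leaves no vertex adjacent to the whole opposite part, so a
  total dominating set needs two vertices in each part. Conversely, let deleting \<open>F\<close> raise the total
  domination number to at least 4. If every vertex of \<open>V\<close> lies on an edge of \<open>F\<close>, then \<open>F\<close> has at
  least \<open>b\<close> edges. Otherwise some \<open>v\<close> in \<open>V\<close> still dominates \<open>U\<close>, so no two vertices of \<open>U\<close> dominate
  \<open>V\<close> together; as there are no isolated vertices, this forces each vertex of \<open>U\<close> onto two edges
  of \<open>F\<close>, whence \<open>F\<close> has at least \<open>2 a\<close> edges.
\<close>

lemma dominates_delete_edges:
  "u \<rightarrow>\<^bsub>delete_edges G F\<^esub> v \<longleftrightarrow> u \<rightarrow>\<^bsub>G\<^esub> v \<and> {u, v} \<notin> F"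
  by (auto simp: delete_edges_def arcs_ends_conv)

lemma verts_delete_edges [simp]: "verts (delete_edges G F) = verts G"
  by (simp add: delete_edges_def)

text \<open>Lower bounds pass through the infimum, so each one reduces to a cardinality bound for
  every total dominating set. If there is none, the value is \<open>\<infinity>\<close> and both
  sides hold.\<close>

lemma le_total_domination_number_iff:
  "enat n \<le> total_domination_number G \<longleftrightarrow> (\<forall>S. total_dominating_set G S \<longrightarrow> n \<le> card S)"
  by (auto simp: total_domination_number_def le_INF_iff)

lemma two_le_cardI: "\<lbrakk>finite A; x \<in> A; y \<in> A; x \<noteq> y\<rbrakk> \<Longrightarrow> 2 \<le> card A"
  using card_mono[of A "{x, y}"] by simp

text \<open>The parts are fixed but their sizes are left open, so that each bound names only the
  cardinality hypotheses it uses.\<close>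

locale complete_bipartite =
  fixes G :: "('a, 'b) pre_digraph" and U V :: "'a set"
  assumes finite_parts: "finite U" "finite V"
    and nonempty_parts: "U \<noteq> {}" "V \<noteq> {}"
    and verts_eq: "verts G = U \<union> V"
    and disjoint_parts: "U \<inter> V = {}"
    and arcs_ends_eq: "arcs_ends G = U \<times> V \<union> V \<times> U"
begin

lemma dominates_iff: "u \<rightarrow>\<^bsub>G\<^esub> v \<longleftrightarrow> u \<in> U \<and> v \<in> V \<or> u \<in> V \<and> v \<in> U"
  by (auto simp: arcs_ends_eq)

lemma undirected_edges_eq: "undirected_edges G = {{u, v} | u v. u \<in> U \<and> v \<in> V}"
  unfolding undirected_edges_def dominates_iff by (auto simp: insert_commute)

lemma finite_undirected_edges: "finite (undirected_edges G)"
  unfolding undirected_edges_eq using finite_parts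
  by (auto intro: finite_image_set2[of "\<lambda>u. u \<in> U" "\<lambda>v. v \<in> V"])

lemma finite_total_dominating_set: "total_dominating_set (delete_edges G F) S \<Longrightarrow> finite S"
  using finite_parts by (auto simp: total_dominating_set_def verts_eq intro: finite_subset)

lemma total_domination_number_eq: "total_domination_number G = 2"
proof -
  obtain u v where uv: "u \<in> U" "v \<in> V" using nonempty_parts by auto
  have ne: "u \<noteq> v" using uv disjoint_parts by auto
  have "total_dominating_set G {u, v}"
    using uv by (auto simp: total_dominating_set_def verts_eq dominates_iff)
  then have "total_domination_number G \<le> enat (card {u, v})"
    unfolding total_domination_number_def by (intro INF_lower) simp
  then have "total_domination_number G \<le> enat 2"
    using ne by (simp add: numeral_2_eq_2)
  moreover have "enat 2 \<le> total_domination_number G"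
    unfolding le_total_domination_number_iff
  proof (intro allI impI)
    fix S assume S: "total_dominating_set G S"
    obtain x where x: "x \<in> S" "x \<in> V"
      using S uv disjoint_parts
      by (fastforce simp: total_dominating_set_def verts_eq dominates_iff)
    obtain y where y: "y \<in> S" "y \<in> U"
      using S uv disjoint_parts
      by (fastforce simp: total_dominating_set_def verts_eq dominates_iff)
    have "finite S"
      using S finite_parts by (auto simp: total_dominating_set_def verts_eq intro: finite_subset)
    then show "2 \<le> card S"
      using x y disjoint_parts by (intro two_le_cardI[of S x y]) auto
  qed
  ultimately show ?thesis by (simp add: numeral_eq_enat)
qed

lemma total_bondage_number_le:
  assumes "2 \<le> card U" "card U \<le> card V"
  shows "total_bondage_number 2 G \<le> enat (card V)"
proof -
  \<comment> \<open>An injection of \<open>U\<close> into \<open>V\<close> is turned into a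
    surjection back, since \<open>U\<close> is nonempty.\<close>
  obtain f where f: "f ` V = U"
    using card_le_inj[OF finite_parts assms(2)] inj_on_iff_surj[OF nonempty_parts(1), of V] by blast
  define F where "F = (\<lambda>v. {f v, v}) ` V"
  have fU: "f v \<in> U" if "v \<in> V" for v using f that by auto
  have F_iff: "{u, v} \<in> F \<longleftrightarrow> u = f v" if "u \<in> U" "v \<in> V" for u v
    unfolding F_def using that disjoint_parts fU by (auto simp: doubleton_eq_iff)
  let ?H = "delete_edges G F"
  have adj: "u \<rightarrow>\<^bsub>?H\<^esub> v \<longleftrightarrow> u \<noteq> f v" "v \<rightarrow>\<^bsub>?H\<^esub> u \<longleftrightarrow> u \<noteq> f v" if "u \<in> U" "v \<in> V" for u v
    using that F_iff[OF that] by (auto simp: dominates_delete_edges dominates_iff insert_commute)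
  have no_iso: "no_isolated_vertices ?H"
    unfolding no_isolated_vertices_def
  proof
    fix x assume "x \<in> verts ?H"
    then consider "x \<in> U" | "x \<in> V" by (auto simp: verts_eq)
    then show "\<exists>y\<in>verts ?H. x \<rightarrow>\<^bsub>?H\<^esub> y"
    proof cases
      case 1
      \<comment> \<open>A vertex of \<open>V\<close> that \<open>f\<close> sends to some
        \<open>u \<noteq> x\<close> keeps its edge to \<open>x\<close>.\<close>
      obtain u where "u \<in> U" "u \<noteq> x"
        using assms(1) by (metis card_le_Suc0_iff_eq finite_parts(1) not_less_eq_eq numeral_2_eq_2 1)
      then obtain v where "v \<in> V" "f v = u" using f by auto
      then show ?thesis using 1 \<open>u \<noteq> x\<close> adj by (auto simp: verts_eq)
    next
      case 2
      obtain u where "u \<in> U" "u \<noteq> f x"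
        using assms(1) fU[OF 2]
        by (metis card_le_Suc0_iff_eq finite_parts(1) not_less_eq_eq numeral_2_eq_2)
      then show ?thesis using adj(2)[OF _ 2] by (auto simp: verts_eq)
    qed
  qed
  have "enat 4 \<le> total_domination_number ?H"
    unfolding le_total_domination_number_iff
  proof (intro allI impI)
    fix S assume S: "total_dominating_set ?H S"
    have dom: "\<exists>y\<in>S. x \<rightarrow>\<^bsub>?H\<^esub> y" if "x \<in> U \<union> V" for x
      using S that by (auto simp: total_dominating_set_def verts_eq)
    have domU: "\<exists>v\<in>S \<inter> V. u \<noteq> f v" if "u \<in> U" for u
      using dom[of u] that adj disjoint_parts
      by (fastforce simp: dominates_delete_edges dominates_iff)
    have domV: "\<exists>u\<in>S \<inter> U. u \<noteq> f v" if "v \<in> V" for v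
      using dom[of v] that adj disjoint_parts
      by (fastforce simp: dominates_delete_edges dominates_iff)
    have fin: "finite S" using S by (rule finite_total_dominating_set)
    obtain v1 where v1: "v1 \<in> S \<inter> V" using domU nonempty_parts by blast
    \<comment> \<open>The vertex \<open>f v1\<close> is no longer adjacent to \<open>v1\<close>, so
      \<open>S\<close> needs another vertex of \<open>V\<close> to dominate it.\<close>
    obtain v2 where v2: "v2 \<in> S \<inter> V" "f v1 \<noteq> f v2" using domU fU v1 by blast
    obtain u1 where u1: "u1 \<in> S \<inter> U" using domV nonempty_parts by blast
    \<comment> \<open>Surjectivity of \<open>f\<close> provides a vertex that \<open>u1\<close>
      fails to dominate.\<close>
    obtain v where "v \<in> V" "f v = u1" using u1 f by auto
    then obtain u2 where u2: "u2 \<in> S \<inter> U" "u2 \<noteq> u1" using domV by blast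
    have "2 \<le> card (S \<inter> V)" using fin v1 v2 by (intro two_le_cardI[of _ v1 v2]) auto
    moreover have "2 \<le> card (S \<inter> U)" using fin u1 u2 by (intro two_le_cardI[of _ u1 u2]) auto
    moreover have "card (S \<inter> U \<union> S \<inter> V) = card (S \<inter> U) + card (S \<inter> V)"
      using fin disjoint_parts by (intro card_Un_disjoint) auto
    moreover have "card (S \<inter> U \<union> S \<inter> V) \<le> card S"
      using fin by (intro card_mono) auto
    ultimately show "4 \<le> card S" by linarith
  qed
  then have "total_domination_number G + enat 2 \<le> total_domination_number ?H"
    by (simp add: total_domination_number_eq numeral_eq_enat)
  moreover have "F \<subseteq> undirected_edges G"
    unfolding F_def undirected_edges_eq using fU by blast
  ultimately have "total_bondage_number 2 G \<le> enat (card F)"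
    using no_iso unfolding total_bondage_number_def by (intro INF_lower) auto
  also have "card F \<le> card V"
    unfolding F_def using finite_parts by (intro card_image_le)
  finally show ?thesis by simp
qed

text \<open>The two terms of the minimum come from the two cases: whether or not \<open>F\<close>
  meets every vertex of \<open>V\<close>. The bound \<open>b \<le> 2 * a\<close> is applied only
  afterwards, to evaluate the minimum.\<close>

lemma card_deleted_edges_ge:
  assumes "2 \<le> card U" and F: "F \<subseteq> undirected_edges G"
    and no_iso: "no_isolated_vertices (delete_edges G F)"
    and dom_num: "enat 4 \<le> total_domination_number (delete_edges G F)"
  shows "min (card V) (2 * card U) \<le> card F"
proof -
  let ?H = "delete_edges G F"
  have finF: "finite F" using F finite_undirected_edges by (rule finite_subset)
  show ?thesis
  proof (cases "\<forall>v\<in>V. \<exists>u\<in>U. {u, v} \<in> F")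
    case True
    then obtain g where g: "g v \<in> U" "{g v, v} \<in> F" if "v \<in> V" for v by metis
    have "inj_on (\<lambda>v. {g v, v}) V"
      using disjoint_parts g(1) by (auto simp: inj_on_def doubleton_eq_iff)
    then have "card V \<le> card F"
      using g(2) finF by (intro card_inj_on_le) auto
    then show ?thesis by simp
  next
    case False
    then obtain w where w: "w \<in> V" "\<And>u. u \<in> U \<Longrightarrow> {u, w} \<notin> F" by blast
    \<comment> \<open>Otherwise \<open>w\<close> dominates \<open>U\<close> and \<open>x\<close>,
      \<open>y\<close> together dominate \<open>V\<close>, a total dominating set of at most 3
      vertices. The case \<open>x = y\<close> is included on purpose.\<close>
    have pair: "\<exists>v\<in>V. {x, v} \<in> F \<and> {y, v} \<in> F" if "x \<in> U" "y \<in> U" for x y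
    proof (rule ccontr)
      assume "\<not> ?thesis"
      then have "total_dominating_set ?H {w, x, y}"
        using w that
        by (auto simp: total_dominating_set_def verts_eq dominates_delete_edges
            dominates_iff insert_commute)
      then have "4 \<le> card {w, x, y}"
        using dom_num by (simp only: le_total_domination_number_iff)
      moreover have "card {w, x, y} \<le> 3"
        using card_insert_le_m1[of 3 "{x, y}" w] card_insert_le_m1[of 2 "{y}" x] by simp
      ultimately show False by simp
    qed
    have two: "2 \<le> card {e \<in> F. x \<in> e}" if x: "x \<in> U" for x
    proof -
      \<comment> \<open>The instance \<open>y = x\<close> gives a first deleted edge at
        \<open>x\<close>. A surviving neighbour \<open>y\<close> of \<open>v\<close> then forces a
        second one: \<open>x\<close> and \<open>y\<close> have deleted edges to a common
        \<open>v'\<close>, which cannot be \<open>v\<close>.\<close>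
      obtain v where v: "v \<in> V" "{x, v} \<in> F" using pair[OF x x] by blast
      have "v \<in> verts ?H" using v by (simp add: verts_eq)
      then obtain y where y: "v \<rightarrow>\<^bsub>?H\<^esub> y" using no_iso by (auto simp: no_isolated_vertices_def)
      then have yU: "y \<in> U" "{y, v} \<notin> F"
        using v disjoint_parts by (auto simp: dominates_delete_edges dominates_iff insert_commute)
      then obtain v' where v': "v' \<in> V" "{x, v'} \<in> F" "{y, v'} \<in> F" using pair[OF x] by blast
      then have "v \<noteq> v'" using yU by auto
      then have "{x, v} \<noteq> {x, v'}" by (auto simp: doubleton_eq_iff)
      then show ?thesis using v v' finF by (intro two_le_cardI[of _ "{x, v}" "{x, v'}"]) auto
    qed
    \<comment> \<open>Every edge of \<open>F\<close> has exactly one end in \<open>U\<close>, so the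
      sets of deleted edges at different vertices of \<open>U\<close> are disjoint and their sizes
      add up.\<close>
    have "2 * card U \<le> (\<Sum>x\<in>U. card {e \<in> F. x \<in> e})"
      using sum_mono[of U "\<lambda>_. 2" "\<lambda>x. card {e \<in> F. x \<in> e}"] two by (simp add: mult.commute)
    also have "\<dots> = card (\<Union>x\<in>U. {e \<in> F. x \<in> e})"
    proof (rule card_UN_disjoint[symmetric])
      show "\<forall>x\<in>U. \<forall>y\<in>U. x \<noteq> y \<longrightarrow> {e \<in> F. x \<in> e} \<inter> {e \<in> F. y \<in> e} = {}"
        using F disjoint_parts unfolding undirected_edges_eq by fastforce
    qed (use finite_parts finF in auto)
    also have "\<dots> \<le> card F" using finF by (intro card_mono) auto
    finally show ?thesis by simp
  qed
qed

lemma total_bondage_number_ge: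
  assumes "2 \<le> card U" "card V \<le> 2 * card U"
  shows "enat (card V) \<le> total_bondage_number 2 G"
  unfolding total_bondage_number_def
proof (rule INF_greatest)
  fix F
  assume "F \<in> {F. F \<subseteq> undirected_edges G \<and> no_isolated_vertices (delete_edges G F)
    \<and> total_domination_number (delete_edges G F) \<ge> total_domination_number G + enat 2}"
  then have "min (card V) (2 * card U) \<le> card F"
    using assms(1) by (intro card_deleted_edges_ge)
      (auto simp: total_domination_number_eq numeral_eq_enat)
  then show "enat (card V) \<le> enat (card F)" using assms(2) by simp
qed

end

theorem theorem3p20:
  fixes G :: "('a, 'b) pre_digraph" and a b :: nat
  assumes "2 \<le> a" and "a \<le> b" and "b \<le> 2 * a"
    and "K\<^bsub>a,b\<^esub> G"
  shows "total_bondage_number 2 G = enat b"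
proof -
  obtain U V where UV: "verts G = U \<union> V" "U \<inter> V = {}" "card U = a" "card V = b"
      "arcs_ends G = U \<times> V \<union> V \<times> U"
    using assms(4) by (auto simp: complete_bipartite_digraph_def)
  \<comment> \<open>Infinite sets have \<open>card\<close> equal to 0, so positive sizes give
    finiteness as well as nonemptiness.\<close>
  have "finite U" "finite V" "U \<noteq> {}" "V \<noteq> {}"
    using assms UV by (auto intro: card_ge_0_finite)
  then interpret complete_bipartite G U V
    using UV by unfold_locales auto
  show ?thesis
    using total_bondage_number_le total_bondage_number_ge assms UV by (simp add: antisym)
qed

end
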